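(* For every integer $n>0$, let $b=\lfloor \log_2 n\rfloor$ and $c=n+1-2^{b}$ (so $1\le c\le 2^b$). Then $d_3(n)=6c-3$.
   Context: A P-position of the game of Nim with $k$ piles is a $k$-tuple $(p_1,\dots,p_k)$ of non-negative integers (piles of size $0$ allowed) whose nim-sum $p_1\oplus p_2\oplus\cdots\oplus p_k$ is $0$, where $\oplus$ denotes bitwise XOR of binary representations. $d_k(n)$ denotes the number of P-positions with $k$ piles whose largest pile has exactly $n$ counters (i.e. $\max_i p_i=n$). *)

theory Defs
  imports Complex_Main
begin

context
  includes bit_operations_syntax
begin

definition nim_sum :: "nat list \<Rightarrow> nat" where
  "nim_sum ps = foldr (XOR) ps 0"

end

definition P_positions :: "nat \<Rightarrow> nat list set" where
  "P_positions k = {ps. length ps = k \<and> nim_sum ps = 0}"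

(* Nonemptiness excludes only k = 0, where there is no largest pile and Max is unspecified. *)
definition num_P_positions :: "nat \<Rightarrow> nat \<Rightarrow> nat" where
  "num_P_positions k n = card {ps \<in> P_positions k. ps \<noteq> [] \<and> Max (set ps) = n}"

end

theory Submission
  imports Defs
begin

text \<open>
  Write \<open>Y\<close> for the set of \<open>y \<le> n\<close> with \<open>y XOR n \<le> n\<close>. Since \<open>y\<close> and \<open>y XOR n\<close> differ in the leading
  bit \<open>b\<close> of \<open>n\<close>, the map \<open>y \<mapsto> y XOR n\<close> exchanges the two halves of \<open>Y\<close> below and above \<open>2 ^ b\<close>, and
  the upper half is \<open>{2 ^ b..n}\<close>; hence \<open>card Y = 2c\<close>. A position with largest pile \<open>n\<close> is a
  permutation of \<open>(n, y, y XOR n)\<close> with \<open>y \<in> Y\<close>. The three places for \<open>n\<close> give \<open>2c\<close> positions each,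
  and the three arrangements of \<open>(n, n, 0)\<close> are counted twice, which leaves \<open>6c - 3\<close>.
\<close>

context
  includes bit_operations_syntax
begin

lemma xor_less_power_iff:
  fixes y n b :: nat
  assumes n: "2 ^ b \<le> n" "n < 2 ^ Suc b" and y: "y < 2 ^ Suc b"
  shows "y XOR n < 2 ^ b \<longleftrightarrow> 2 ^ b \<le> y"
proof -
  \<comment> \<open>Below \<open>2 ^ Suc b\<close>, a shift by \<open>b\<close> leaves only bit
    \<open>b\<close>. This bit is set in \<open>n\<close>, so XOR with \<open>n\<close> flips
    it.\<close>
  have high: "drop_bit b m = of_bool (2 ^ b \<le> m)" if "m < 2 ^ Suc b" for m :: nat
  proof (cases "2 ^ b \<le> m")
    case True
    then have "m div 2 ^ b = Suc ((m - 2 ^ b) div 2 ^ b)"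
      by (simp add: le_div_geq)
    with True that show ?thesis by (simp add: drop_bit_eq_div)
  qed (simp add: drop_bit_eq_div)
  have "y XOR n < 2 ^ b \<longleftrightarrow> drop_bit b (y XOR n) = 0"
    by (simp add: drop_bit_eq_div div_eq_0_iff)
  also have "\<dots> \<longleftrightarrow> 2 ^ b \<le> y"
    using n y by (simp add: high drop_bit_xor del: power_Suc)
  finally show ?thesis .
qed

lemma xor_right_cancel_nat [simp]: "(y XOR n) XOR n = (y :: nat)"
  by (simp add: xor.assoc)

lemma xor_left_cancel_nat: "x XOR (x XOR n) = (n :: nat)"
  by (simp flip: xor.assoc)

lemma xor_eq_right_iff_nat [simp]: "y XOR n = n \<longleftrightarrow> y = (0 :: nat)"
  by (metis xor_right_cancel_nat xor_self_eq xor.left_neutral)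

lemma xor_eq_0_iff_nat: "x XOR y = 0 \<longleftrightarrow> x = (y :: nat)"
  by (metis xor_right_cancel_nat xor_self_eq xor.left_neutral)

lemma card_xor_le:
  fixes n b :: nat
  assumes n: "2 ^ b \<le> n" "n < 2 ^ Suc b"
  shows "card {y. y \<le> n \<and> y XOR n \<le> n} = 2 * (n + 1 - 2 ^ b)"
proof -
  let ?U = "{2 ^ b..n}" and ?f = "\<lambda>y. y XOR n"
  have low: "y XOR n < 2 ^ b \<longleftrightarrow> 2 ^ b \<le> y" if "y \<le> n" for y
    using xor_less_power_iff[OF n] that n(2) by simp
  have "{y. y \<le> n \<and> y XOR n \<le> n} = ?U \<union> ?f ` ?U" (is "?Y = _")
  proof (intro subset_antisym subsetI)
    fix y assume y: "y \<in> ?Y"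
    show "y \<in> ?U \<union> ?f ` ?U"
    proof (cases "2 ^ b \<le> y")
      case False
      \<comment> \<open>Here \<open>low\<close> puts \<open>y XOR n\<close> in the upper half, and
        \<open>y\<close> is its image because \<open>?f\<close> is an involution.\<close>
      then have "y XOR n \<in> ?U" using y low[of y] by auto
      then have "?f (y XOR n) \<in> ?f ` ?U" by (rule imageI)
      then show ?thesis by simp
    qed (use y in auto)
  next
    fix y assume "y \<in> ?U \<union> ?f ` ?U"
    then show "y \<in> ?Y" using low n by fastforce
  qed
  \<comment> \<open>By \<open>low\<close>, the image lies entirely below
    \<open>2 ^ b\<close>.\<close>
  moreover have "?U \<inter> ?f ` ?U = {}"
    using low by fastforce
  moreover have "inj_on ?f ?U"
    by (metis inj_onI xor_right_cancel_nat)
  ultimately show ?thesis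
    by (simp add: card_Un_disjoint card_image)
qed

lemma P_positions_3_iff:
  "ps \<in> P_positions 3 \<longleftrightarrow> (\<exists>x y. ps = [x, y, x XOR y])"
proof
  assume "ps \<in> P_positions 3"
  then obtain x y z where ps: "ps = [x, y, z]" and "x XOR (y XOR z) = 0"
    by (auto simp: P_positions_def nim_sum_def numeral_3_eq_3 length_Suc_conv)
  then have "x XOR y = z"
    by (simp add: xor_eq_0_iff_nat flip: xor.assoc)
  with ps show "\<exists>x y. ps = [x, y, x XOR y]" by blast
next
  assume "\<exists>x y. ps = [x, y, x XOR y]"
  then show "ps \<in> P_positions 3"
    by (auto simp: P_positions_def nim_sum_def xor.commute xor.left_commute)
qed

lemma num_P_positions_3:
  fixes n b :: nat
  assumes n: "2 ^ b \<le> n" "n < 2 ^ Suc b"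
  shows "num_P_positions 3 n = 6 * (n + 1 - 2 ^ b) - 3"
proof -
  define Y where "Y = {y. y \<le> n \<and> y XOR n \<le> n}"
  have fin: "finite Y" unfolding Y_def by simp
  have n0: "n > 0" using n(1) by (rule less_le_trans[rotated]) simp
  have mem: "0 \<in> Y" "n \<in> Y" by (auto simp: Y_def)
  \<comment> \<open>Positions are sorted by the first place where \<open>n\<close> occurs. In
    \<open>?B\<close>, \<open>y = n\<close> would put \<open>n\<close> first; in \<open>?C\<close>,
    \<open>y = n\<close> would put it first and \<open>y = 0\<close> second.\<close>
  let ?A = "(\<lambda>y. [n, y, y XOR n]) ` Y"
  let ?B = "(\<lambda>y. [y, n, y XOR n]) ` (Y - {n})"
  let ?C = "(\<lambda>y. [y, y XOR n, n]) ` (Y - {0, n})"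
  have "{ps \<in> P_positions 3. ps \<noteq> [] \<and> Max (set ps) = n} = ?A \<union> ?B \<union> ?C" (is "?S = _")
  proof (intro subset_antisym subsetI)
    fix ps assume "ps \<in> ?S"
    then obtain x y where ps: "ps = [x, y, x XOR y]" and mx: "Max {x, y, x XOR y} = n"
      by (auto simp: P_positions_3_iff)
    have le: "x \<le> n" "y \<le> n" "x XOR y \<le> n"
      using mx by (auto intro: Max_ge)
    have "n \<in> {x, y, x XOR y}"
      using Max_in[of "{x, y, x XOR y}"] mx by simp
    then consider "x = n" | "y = n" "x \<noteq> n" | "x XOR y = n" "x \<noteq> n" "y \<noteq> n" by auto
    then show "ps \<in> ?A \<union> ?B \<union> ?C"
    proof cases
      case 1
      then show ?thesis using ps le by (auto simp: Y_def xor.commute)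
    next
      case 2
      then show ?thesis using ps le by (auto simp: Y_def)
    next
      case 3
      then have "y = x XOR n"
        by (metis xor.commute xor_right_cancel_nat)
      then have "ps = [x, x XOR n, n]" "x \<in> Y"
        using ps le 3(1) by (simp_all add: Y_def)
      \<comment> \<open>With \<open>x = 0\<close>, the XOR would be \<open>y\<close>, forcing
        \<open>y = n\<close> against the case.\<close>
      moreover have "x \<noteq> 0" using 3 by (cases "x = 0") auto
      ultimately show ?thesis using 3(2) by blast
    qed
  next
    fix ps assume "ps \<in> ?A \<union> ?B \<union> ?C"
    then obtain y where y: "y \<in> Y"
      and ps: "ps = [n, y, y XOR n] \<or> ps = [y, n, y XOR n] \<or> ps = [y, y XOR n, n]"
      by blast
    \<comment> \<open>These identities bring the first and third shapes into the form
      \<open>[x, y, x XOR y]\<close>; the second already has it.\<close>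
    have "y XOR n = n XOR y" "y XOR (y XOR n) = n"
      by (rule xor.commute, rule xor_left_cancel_nat)
    with ps have "ps \<in> P_positions 3"
      unfolding P_positions_3_iff by metis
    moreover have "Max (set ps) = n"
      using ps y by (intro Max_eqI) (auto simp: Y_def)
    ultimately show "ps \<in> ?S" using ps by blast
  qed
  moreover have "?A \<inter> ?B = {}" "(?A \<union> ?B) \<inter> ?C = {}"
    by (auto dest: xor_eq_right_iff_nat[THEN iffD1, OF sym])
  then have "card (?A \<union> ?B \<union> ?C) = card ?A + card ?B + card ?C"
    using fin by (simp only: card_Un_disjoint finite_UnI finite_imageI finite_Diff)
  \<comment> \<open>By \<open>n0\<close>, \<open>0\<close> and \<open>n\<close> are distinct
    elements of \<open>Y\<close>, so \<open>?C\<close> loses exactly two and the truncated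
    subtractions are exact.\<close>
  moreover have "card ?A = card Y" "card ?B = card Y - 1" "card ?C = card Y - 2"
    using fin mem n0 by (simp_all add: card_image inj_on_def card_Diff_subset)
  ultimately show ?thesis
    using card_xor_le[OF n] n(1) by (simp add: num_P_positions_def Y_def numeral_3_eq_3)
qed

end

theorem theorem11:
  fixes n b :: nat and c :: int
  assumes "n > 0"
    and "b = nat \<lfloor>log 2 (real n)\<rfloor>"
    and "c = int n + 1 - 2 ^ b"
  shows "1 \<le> c \<and> c \<le> 2 ^ b \<and> int (num_P_positions 3 n) = 6 * c - 3"
proof -
  \<comment> \<open>As \<open>n \<ge> 1\<close>, the logarithm is nonnegative and \<open>nat\<close>
    does not truncate.\<close>
  have "\<lfloor>log 2 (real n)\<rfloor> = int b"
    using assms(1,2) by simp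
  then have n: "2 ^ b \<le> n" "n < 2 ^ Suc b"
    using floor_log_nat_eq_powr_iff[of 2 n b] assms(1) by simp_all
  have c: "c = int (n + 1 - 2 ^ b)"
    using n(1) assms(3) by (simp add: of_nat_diff)
  have "1 \<le> n + 1 - 2 ^ b" "n + 1 - 2 ^ b \<le> 2 ^ b"
    using n by simp_all
  moreover have "int (2 ^ b) = 2 ^ b" by simp
  ultimately show ?thesis
    using num_P_positions_3[OF n] unfolding c by linarith
qed

end
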